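(* Let $\Sigma$ be a finite alphabet, let $k\in\mathbb{N}$ and let $w,\tilde w\in\Sigma^*$ with $m\coloneqq\iota(w)=\iota(\tilde w)<k$. Let $w=\alpha_0\beta_1\alpha_1\cdots\beta_m\alpha_m$ and $\tilde w=\tilde\alpha_0\tilde\beta_1\tilde\alpha_1\cdots\tilde\beta_m\tilde\alpha_m$ be their $\alpha$-$\beta$-factorizations. Then $w\sim_k\tilde w$ if and only if $\alpha_{i-1}\beta_i\alpha_i\sim_{k-m+1}\tilde\alpha_{i-1}\tilde\beta_i\tilde\alpha_i$ for all $i\in\{1,\dots,m\}$.
   Context: A word $u$ is a scattered factor of $w$ (written $u\preceq w$) if $w=v_0u[1]v_1\cdots v_{n-1}u[n]v_n$ for some words $v_0,\dots,v_n$, where $n=|u|$. For $k\in\mathbb{N}_0$, $u\sim_k v$ (Simon's congruence) iff $u$ and $v$ have exactly the same scattered factors of length at most $k$. $\iota(w)$ (universality index w.r.t. $\Sigma$) is the largest $\ell$ such that every word of $\Sigma^\ell$ is a scattered factor of $w$. The arch factorization of $w$ is the unique factorization $w=\mathrm{ar}_1(w)\cdots\mathrm{ar}_\ell(w)\mathrm{re}(w)$ where each arch $\mathrm{ar}_i(w)$ contains every letter of $\Sigma$ and its last letter occurs exactly once in it, and the rest $\mathrm{re}(w)$ does not contain every letter of $\Sigma$; here $\ell=\iota(w)$. With $w^R$ the reversal of $w$, define reverse arches $\mathrm{ra}_i(w)\coloneqq(\mathrm{ar}_{\iota(w)-i+1}(w^R))^R$ and reverse rest $\mathrm{er}(w)\coloneqq(\mathrm{re}(w^R))^R$.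 The $\alpha$-$\beta$-factorization of $w$ is $w=\alpha_0\beta_1\alpha_1\cdots\alpha_{\iota(w)-1}\beta_{\iota(w)}\alpha_{\iota(w)}$ with $\mathrm{ar}_i(w)=\alpha_{i-1}\beta_i$ and $\mathrm{ra}_i(w)=\beta_i\alpha_i$ for all $i\in\{1,\dots,\iota(w)\}$, $\alpha_0=\mathrm{er}(w)$ and $\alpha_{\iota(w)}=\mathrm{re}(w)$.
   Formalization: The formal theorem additionally assumes m ≥ 1; for m = 0 the right-hand side is vacuous and the claim fails, e.g. Σ = {a,b}, w = a, w̃ = b, k = 1. *)

theory Defs
  imports Main "HOL-Library.Sublist"
begin

text \<open>Words are lists, the alphabet is a set \<open>S\<close>, a word over \<open>S\<close> is an element of \<open>lists S\<close>, and
  \<open>u\<close> is a scattered factor of \<open>w\<close> iff \<open>subseq u w\<close>.\<close>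

definition simon_cong :: "nat \<Rightarrow> 'a list \<Rightarrow> 'a list \<Rightarrow> bool" where
  "simon_cong k u v \<longleftrightarrow> (\<forall>x. length x \<le> k \<longrightarrow> (subseq x u \<longleftrightarrow> subseq x v))"

definition univ_index :: "'a set \<Rightarrow> 'a list \<Rightarrow> nat" where
  "univ_index S w = (GREATEST l. \<forall>u \<in> lists S. length u = l \<longrightarrow> subseq u w)"

definition is_arch :: "'a set \<Rightarrow> 'a list \<Rightarrow> bool" where
  "is_arch S a \<longleftrightarrow> S \<subseteq> set a \<and> count_list a (last a) = 1"

definition is_arch_factorization :: "'a set \<Rightarrow> 'a list \<Rightarrow> 'a list list \<Rightarrow> 'a list \<Rightarrow> bool" where
  "is_arch_factorization S w as r \<longleftrightarrow>
     w = concat as @ r \<and> (\<forall>a \<in> set as. is_arch S a) \<and> \<not> S \<subseteq> set r"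

text \<open>Existence and uniqueness of the arch factorization of a word over a nonempty alphabet, and
  the fact that it has \<open>univ_index S w\<close> many arches, are proved at the end of this theory.\<close>

definition arch_factorization :: "'a set \<Rightarrow> 'a list \<Rightarrow> 'a list list \<times> 'a list" where
  "arch_factorization S w = (THE (as, r). is_arch_factorization S w as r)"

text \<open>Arches are numbered from 1.\<close>

definition ar :: "'a set \<Rightarrow> 'a list \<Rightarrow> nat \<Rightarrow> 'a list" where
  "ar S w i = fst (arch_factorization S w) ! (i - 1)"

definition re :: "'a set \<Rightarrow> 'a list \<Rightarrow> 'a list" where
  "re S w = snd (arch_factorization S w)"

definition ra :: "'a set \<Rightarrow> 'a list \<Rightarrow> nat \<Rightarrow> 'a list" where
  "ra S w i = rev (ar S (rev w) (univ_index S w - i + 1))"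

definition er :: "'a set \<Rightarrow> 'a list \<Rightarrow> 'a list" where
  "er S w = rev (re S (rev w))"

text \<open>Only the values of \<open>\<alpha>\<close> on \<open>{0..univ_index S w}\<close> and of \<open>\<beta>\<close> on \<open>{1..univ_index S w}\<close> matter.\<close>

definition is_alpha_beta_factorization ::
    "'a set \<Rightarrow> 'a list \<Rightarrow> (nat \<Rightarrow> 'a list) \<Rightarrow> (nat \<Rightarrow> 'a list) \<Rightarrow> bool" where
  "is_alpha_beta_factorization S w \<alpha> \<beta> \<longleftrightarrow>
     w = \<alpha> 0 @ concat (map (\<lambda>i. \<beta> i @ \<alpha> i) [1..<Suc (univ_index S w)]) \<and>
     (\<forall>i \<in> {1..univ_index S w}. ar S w i = \<alpha> (i - 1) @ \<beta> i \<and> ra S w i = \<beta> i @ \<alpha> i) \<and>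
     \<alpha> 0 = er S w \<and> \<alpha> (univ_index S w) = re S w"

lemma is_arch_iff:
  "is_arch S a \<longleftrightarrow> S \<subseteq> set a \<and> a \<noteq> [] \<and> last a \<notin> set (butlast a)"
  by (cases a rule: rev_cases) (auto simp: is_arch_def count_list_0_iff)

lemma arch_factorization_exists:
  assumes "S \<noteq> {}"
  shows "\<exists>as r. is_arch_factorization S w as r"
proof (induction w rule: length_induct)
  case (1 w)
  show ?case
  proof (cases "S \<subseteq> set w")
    case False
    then have "is_arch_factorization S w [] w" by (simp add: is_arch_factorization_def)
    then show ?thesis by blast
  next
    case True
    define n where "n = (LEAST n. S \<subseteq> set (take n w))"
    have ex: "S \<subseteq> set (take (length w) w)" using True by simp
    have n: "S \<subseteq> set (take n w)" unfolding n_def by (rule LeastI[of _ "length w"]) (rule ex)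
    have nle: "n \<le> length w" unfolding n_def by (rule Least_le) (rule ex)
    have n0: "n \<noteq> 0" using n assms by (metis set_empty2 subset_empty take_0)
    have wne: "w \<noteq> []" using n assms by auto
    have min: "\<not> S \<subseteq> set (take (n - 1) w)"
      using n0 not_less_Least[of "n - 1" "\<lambda>n. S \<subseteq> set (take n w)"] unfolding n_def by force
    have bl: "butlast (take n w) = take (n - 1) w" using nle by (simp add: butlast_take)
    have ne: "take n w \<noteq> []" using n0 wne by simp
    have "set (take n w) = insert (last (take n w)) (set (take (n - 1) w))"
      using arg_cong[OF append_butlast_last_id[OF ne], of set] bl by auto
    then have arch: "is_arch S (take n w)"
      using n min ne bl by (auto simp: is_arch_iff insert_absorb)
    have "length (drop n w) < length w" using n0 wne by simp
    then obtain as r where "is_arch_factorization S (drop n w) as r" using 1 by blast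
    then have "is_arch_factorization S w (take n w # as) r"
      using arch unfolding is_arch_factorization_def
      by (metis append_assoc append_take_drop_id concat.simps(2) set_ConsD)
    then show ?thesis by blast
  qed
qed

lemma is_arch_prefix:
  assumes "is_arch S a" "is_arch S b" "set b \<subseteq> S" "b = a @ z"
  shows "z = []"
proof (rule ccontr)
  assume z: "z \<noteq> []"
  then have "butlast b = a @ butlast z" using assms(4) by (simp add: butlast_append)
  moreover have "last b \<in> S" using assms(2,3) by (auto simp: is_arch_iff)
  ultimately show False using assms(1,2) by (auto simp: is_arch_iff)
qed

lemma arch_factorization_unique:
  assumes "w \<in> lists S" "is_arch_factorization S w as r" "is_arch_factorization S w as' r'"
  shows "as = as' \<and> r = r'"
  using assms
proof (induction as arbitrary: w as')
  case Nil
  then show ?case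
    by (cases as') (auto simp: is_arch_factorization_def is_arch_def)
next
  case (Cons a as)
  show ?case
  proof (cases as')
    case Nil
    then show ?thesis using Cons.prems by (auto simp: is_arch_factorization_def is_arch_def)
  next
    case as': (Cons b bs)
    have e: "w = a @ concat as @ r" "w = b @ concat bs @ r'"
      and arch: "is_arch S a" "is_arch S b"
      using Cons.prems as' by (simp_all add: is_arch_factorization_def)
    have "set w \<subseteq> S" using Cons.prems(1) by auto
    then have sub: "set a \<subseteq> S" "set b \<subseteq> S"
      by (metis e(1) set_append sup.bounded_iff, metis e(2) set_append sup.bounded_iff)
    from e have "(\<exists>z. a = b @ z) \<or> (\<exists>z. b = a @ z)"
      by (metis append_eq_append_conv2)
    then have ab: "a = b"
    proof (elim disjE exE)
      fix z assume z: "a = b @ z"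
      then show ?thesis using is_arch_prefix[OF arch(2,1) sub(1) z] by simp
    next
      fix z assume z: "b = a @ z"
      then show ?thesis using is_arch_prefix[OF arch(1,2) sub(2) z] by simp
    qed
    have "is_arch_factorization S (concat as @ r) as r"
         "is_arch_factorization S (concat as @ r) bs r'"
         "concat as @ r \<in> lists S"
      using Cons.prems as' ab by (simp_all add: is_arch_factorization_def)
    then show ?thesis using Cons.IH ab as' by blast
  qed
qed

lemma arch_factorization_eq:
  assumes "w \<in> lists S" "is_arch_factorization S w as r"
  shows "arch_factorization S w = (as, r)"
  unfolding arch_factorization_def
proof (rule the_equality)
  show "case (as, r) of (as, r) \<Rightarrow> is_arch_factorization S w as r" using assms(2) by simp
  fix p assume "case p of (as, r) \<Rightarrow> is_arch_factorization S w as r"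
  then show "p = (as, r)"
    using arch_factorization_unique[OF assms(1) _ assms(2)] by (cases p) simp
qed

lemma arch_factorization_is:
  assumes "w \<in> lists S" "S \<noteq> {}"
  shows "is_arch_factorization S w (fst (arch_factorization S w)) (snd (arch_factorization S w))"
proof -
  obtain as r where "is_arch_factorization S w as r"
    using arch_factorization_exists[OF assms(2)] by blast
  then show ?thesis using arch_factorization_eq[OF assms(1)] by simp
qed

lemma subseq_arches:
  assumes "\<forall>a \<in> set as. is_arch S a" "u \<in> lists S" "length u = length as"
  shows "subseq u (concat as @ r)"
  using assms
proof (induction as arbitrary: u)
  case (Cons a as)
  then obtain x v where u: "u = x # v" by (cases u) auto
  then have "x \<in> set a" using Cons.prems by (auto simp: is_arch_def)
  then have "subseq [x] a" by (simp add: subseq_singleton_left)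
  moreover have "subseq v (concat as @ r)" using Cons u by auto
  ultimately show ?case using u list_emb_append_mono[of "(=)" "[x]" a v] by simp
qed simp

lemma subseq_Cons_notin:
  assumes "x \<notin> set b" "subseq (x # u) (b @ x # v)"
  shows "subseq u v"
  using assms by (induction b) (auto split: if_splits)

lemma not_subseq_last_arches:
  assumes "\<forall>a \<in> set as. is_arch S a" "c \<notin> set r"
  shows "\<not> subseq (map last as @ c # v) (concat as @ r)"
  using assms
proof (induction as)
  case Nil
  then show ?case using list_emb_set[of "(=)" "c # v" r c] by auto
next
  case (Cons a as)
  then have a: "a \<noteq> []" "last a \<notin> set (butlast a)" by (auto simp: is_arch_iff)
  have e: "concat (a # as) @ r = butlast a @ last a # (concat as @ r)"
    using append_butlast_last_id[OF a(1)] by (metis append.assoc append_Cons append_Nil concat.simps(2))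
  have IH: "\<not> subseq (map last as @ c # v) (concat as @ r)" using Cons by simp
  show ?case
  proof
    assume "subseq (map last (a # as) @ c # v) (concat (a # as) @ r)"
    then have "subseq (last a # (map last as @ c # v)) (butlast a @ last a # (concat as @ r))"
      unfolding e by simp
    from subseq_Cons_notin[OF a(2) this] show False using IH by blast
  qed
qed

lemma univ_index_eq_length:
  assumes "w \<in> lists S" "is_arch_factorization S w as r"
  shows "univ_index S w = length as"
  unfolding univ_index_def
proof (rule Greatest_equality)
  have w: "w = concat as @ r" and arch: "\<forall>a \<in> set as. is_arch S a"
    using assms(2) by (auto simp: is_arch_factorization_def)
  show "\<forall>u \<in> lists S. length u = length as \<longrightarrow> subseq u w"
    using subseq_arches arch w by blast
  fix l assume l: "\<forall>u \<in> lists S. length u = l \<longrightarrow> subseq u w"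
  show "l \<le> length as"
  proof (rule ccontr)
    assume less: "\<not> l \<le> length as"
    obtain c where c: "c \<in> S" "c \<notin> set r" using assms(2) by (auto simp: is_arch_factorization_def)
    let ?u = "map last as @ c # replicate (l - length as - 1) c"
    have "last a \<in> S" if "a \<in> set as" for a
      using that arch assms(1) w by (auto simp: is_arch_iff)
    then have "?u \<in> lists S" using c by auto
    moreover have "length ?u = l" using less by simp
    ultimately show False using l not_subseq_last_arches[OF arch c(2)] w by blast
  qed
qed

end

theory Submission
  imports Defs
begin

text \<open>Placing congruent words next to a \<open>p\<close>-universal word raises the level of the congruence by \<open>p\<close>;
  cancelling \<open>p\<close> arches lowers it by \<open>p\<close>, because a word starting with the last letters of these
  arches uses them up. Write \<open>n = k - m\<close> and \<open>B\<^sub>i = \<alpha>\<^sub>i\<^sub>-\<^sub>1 \<beta>\<^sub>i \<alpha>\<^sub>i\<close>.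

  If \<open>w \<sim>\<^sub>k w'\<close>, then cancelling the first \<open>i - 1\<close> arches and the last \<open>m - i\<close> reverse arches leaves
  \<open>B\<^sub>i\<close> and \<open>B'\<^sub>i\<close>, congruent at level \<open>n + 1\<close>.

  Conversely, \<open>B\<^sub>i \<sim>\<^sub>n\<^sub>+\<^sub>1 B'\<^sub>i\<close> implies \<open>\<alpha>\<^sub>i \<sim>\<^sub>n \<alpha>'\<^sub>i\<close> by cancelling one arch, and so \<open>w\<close> can be turned
  into \<open>w'\<close> from left to right, replacing in turn \<open>\<alpha>\<^sub>0\<close>, \<open>\<beta>\<^sub>1\<close>, \<open>\<alpha>\<^sub>1\<close>, and so on. Replacing \<open>\<alpha>\<^sub>i\<close> keeps the
  class at level \<open>k\<close>, as there are \<open>i\<close> arches before and \<open>m - i\<close> reverse arches after it. So does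
  replacing \<open>\<beta>\<^sub>i\<close> in the block \<open>\<alpha>'\<^sub>i\<^sub>-\<^sub>1 \<beta>\<^sub>i \<alpha>\<^sub>i\<close>, since
  \<open>\<alpha>'\<^sub>i\<^sub>-\<^sub>1 \<beta>\<^sub>i \<alpha>\<^sub>i \<sim> \<alpha>\<^sub>i\<^sub>-\<^sub>1 \<beta>\<^sub>i \<alpha>\<^sub>i \<sim> \<alpha>'\<^sub>i\<^sub>-\<^sub>1 \<beta>'\<^sub>i \<alpha>'\<^sub>i \<sim> \<alpha>'\<^sub>i\<^sub>-\<^sub>1 \<beta>'\<^sub>i \<alpha>\<^sub>i\<close> at level \<open>n + 1\<close>.\<close>

lemma subseq_rev_mono: "subseq u v \<Longrightarrow> subseq (rev u) (rev v)"
proof (induction rule: list_emb.induct)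
  case (list_emb_Cons xs ys y)
  then show ?case by (simp add: subseq_rev_drop_many)
qed (auto intro: list_emb_append_mono)

lemma subseq_rev_iff [simp]: "subseq (rev u) (rev v) \<longleftrightarrow> subseq u v"
  using subseq_rev_mono[of u v] subseq_rev_mono[of "rev u" "rev v"] by auto

lemma subseq_in_lists: "subseq u v \<Longrightarrow> v \<in> lists S \<Longrightarrow> u \<in> lists S"
  by (auto elim: list_emb_set)

lemma rev_in_lists_iff [simp]: "rev u \<in> lists S \<longleftrightarrow> u \<in> lists S"
  by (simp add: in_lists_conv_set)

lemma simon_congI:
  assumes "\<And>x. length x \<le> k \<Longrightarrow> subseq x u \<Longrightarrow> subseq x v"
    and "\<And>x. length x \<le> k \<Longrightarrow> subseq x v \<Longrightarrow> subseq x u"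
  shows "simon_cong k u v"
  using assms by (auto simp: simon_cong_def)

lemma simon_congD: "simon_cong k u v \<Longrightarrow> subseq x u \<Longrightarrow> length x \<le> k \<Longrightarrow> subseq x v"
  by (simp add: simon_cong_def)

lemma simon_cong_refl: "simon_cong k u u"
  by (simp add: simon_cong_def)

lemma simon_cong_sym: "simon_cong k u v \<Longrightarrow> simon_cong k v u"
  by (simp add: simon_cong_def)

lemma simon_cong_trans [trans]: "simon_cong k u v \<Longrightarrow> simon_cong k v x \<Longrightarrow> simon_cong k u x"
  by (simp add: simon_cong_def)

lemma simon_cong_rev_iff: "simon_cong k (rev u) (rev v) \<longleftrightarrow> simon_cong k u v"
  unfolding simon_cong_def by (metis length_rev rev_rev_ident subseq_rev_iff)

definition universal :: "'a set \<Rightarrow> nat \<Rightarrow> 'a list \<Rightarrow> bool" where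
  "universal S p x \<longleftrightarrow> (\<forall>u \<in> lists S. length u \<le> p \<longrightarrow> subseq u x)"

lemma universalD: "universal S p x \<Longrightarrow> u \<in> lists S \<Longrightarrow> length u \<le> p \<Longrightarrow> subseq u x"
  by (simp add: universal_def)

lemma universal_rev_iff: "universal S p (rev x) \<longleftrightarrow> universal S p x"
  unfolding universal_def by (metis length_rev rev_in_lists_iff rev_rev_ident subseq_rev_iff)

lemma universal_Suc_0_iff: "universal S (Suc 0) x \<longleftrightarrow> S \<subseteq> set x"
proof
  assume "universal S (Suc 0) x"
  then have "subseq [c] x" if "c \<in> S" for c using that by (simp add: universal_def)
  then show "S \<subseteq> set x" by (auto simp: subseq_singleton_left)
next
  assume "S \<subseteq> set x"
  then show "universal S (Suc 0) x"
    by (auto simp: universal_def le_Suc_eq length_Suc_conv subseq_singleton_left)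
qed

lemma universal_append:
  assumes "universal S p x" "universal S q y"
  shows "universal S (p + q) (x @ y)"
  unfolding universal_def
proof (intro ballI impI)
  fix u assume "u \<in> lists S" "length u \<le> p + q"
  then have "subseq (take p u) x" "subseq (drop p u) y"
    using assms by (auto intro!: universalD dest: in_set_takeD in_set_dropD)
  then have "subseq (take p u @ drop p u) (x @ y)" by (rule list_emb_append_mono)
  then show "subseq u (x @ y)" by simp
qed

lemma universal_concat:
  "\<forall>a \<in> set as. S \<subseteq> set a \<Longrightarrow> universal S (length as) (concat as)"
proof (induction as)
  case Nil
  show ?case by (simp add: universal_def)
next
  case (Cons a as)
  then show ?case using universal_append[of S "Suc 0" a "length as"]
    by (simp add: universal_Suc_0_iff)
qed

lemma subseq_append_universal_split:
  assumes "universal S p x" "z \<in> lists S" "subseq z (x @ u)" "length z \<le> p + n"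
  obtains s t where "z = s @ t" "subseq s x" "subseq t u" "length t \<le> n"
proof -
  obtain s t where st: "z = s @ t" "subseq s x" "subseq t u"
    using assms(3) by (auto elim: subseq_appendE)
  show thesis
  proof (cases "p \<le> length s")
    case True
    with st assms(4) show thesis by (intro that[of s t]) auto
  next
    case False
    then have "drop p z = drop (p - length s) t" using st(1) by simp
    then have "subseq (drop p z) u"
      by (metis st(3) subseq_order.trans suffix_drop suffix_imp_subseq)
    moreover have "subseq (take p z) x"
      using assms(1,2) by (auto intro!: universalD dest: in_set_takeD)
    ultimately show thesis using assms(4) by (intro that[of "take p z" "drop p z"]) auto
  qed
qed

lemma simon_cong_append_left:
  assumes "universal S p x" "x \<in> lists S" "u \<in> lists S" "v \<in> lists S" "simon_cong n u v"
  shows "simon_cong (p + n) (x @ u) (x @ v)"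
proof -
  have transfer: "subseq z (x @ v')"
    if z: "length z \<le> p + n" "subseq z (x @ u')" and "u' \<in> lists S" "simon_cong n u' v'" for z u' v'
  proof -
    have "z \<in> lists S" using subseq_in_lists[OF z(2)] assms(2) \<open>u' \<in> lists S\<close> by simp
    then obtain s t where "z = s @ t" "subseq s x" "subseq t u'" "length t \<le> n"
      using subseq_append_universal_split[OF assms(1) _ z(2,1)] by blast
    then show ?thesis using \<open>simon_cong n u' v'\<close> by (simp add: list_emb_append_mono simon_congD)
  qed
  show ?thesis
    using transfer assms(3-5) simon_cong_sym by (blast intro: simon_congI)
qed

lemma simon_cong_append_right:
  assumes "universal S q y" "y \<in> lists S" "u \<in> lists S" "v \<in> lists S" "simon_cong n u v"
  shows "simon_cong (n + q) (u @ y) (v @ y)"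
proof -
  have "simon_cong (q + n) (rev y @ rev u) (rev y @ rev v)"
    using assms by (intro simon_cong_append_left) (simp_all add: universal_rev_iff simon_cong_rev_iff)
  then show ?thesis using simon_cong_rev_iff[of _ "u @ y" "v @ y"] by (simp add: add.commute)
qed

lemma simon_cong_context:
  assumes "universal S p x" "universal S q y" "x \<in> lists S" "y \<in> lists S"
    and "u \<in> lists S" "v \<in> lists S" "simon_cong n u v"
  shows "simon_cong (p + n + q) (x @ u @ y) (x @ v @ y)"
proof -
  have "simon_cong (p + (n + q)) (x @ (u @ y)) (x @ (v @ y))"
    using assms by (intro simon_cong_append_left simon_cong_append_right) auto
  then show ?thesis by (simp add: add.assoc)
qed

lemma is_arch_subset: "is_arch S a \<Longrightarrow> S \<subseteq> set a"
  by (simp add: is_arch_def)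

lemma subseq_cancel_arch:
  assumes "is_arch S a" "subseq (last a # x) (a @ u)"
  shows "subseq x u"
proof (rule subseq_Cons_notin)
  have "a \<noteq> []" using assms(1) by (simp add: is_arch_iff)
  then have "butlast a @ last a # u = a @ u"
    by (metis append_butlast_last_id append_Cons append_Nil append_assoc)
  then show "subseq (last a # x) (butlast a @ last a # u)" using assms(2) by (simp only:)
  show "last a \<notin> set (butlast a)" using assms(1) by (simp add: is_arch_iff)
qed

lemma simon_cong_cancel_arch:
  assumes "is_arch S a" "is_arch S b" "a \<in> lists S" "b \<in> lists S"
    and "simon_cong (Suc n) (a @ u) (b @ v)"
  shows "simon_cong n u v"
proof -
  have transfer: "subseq x v'"
    if "length x \<le> n" "subseq x u'"
      and arches: "is_arch S a'" "is_arch S b'" "b' \<in> lists S"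
      and cong: "simon_cong (Suc n) (a' @ u') (b' @ v')"
    for x a' b' u' v'
  proof -
    have "last b' \<in> S" using arches(2,3) by (auto simp: is_arch_iff)
    then have "subseq [last b'] a'" using arches(1) by (auto simp: is_arch_iff subseq_singleton_left)
    from list_emb_append_mono[OF this \<open>subseq x u'\<close>] have "subseq (last b' # x) (a' @ u')" by simp
    with cong \<open>length x \<le> n\<close> have "subseq (last b' # x) (b' @ v')" by (simp add: simon_congD)
    with arches(2) show ?thesis by (rule subseq_cancel_arch)
  qed
  show ?thesis
    using transfer[OF _ _ assms(1,2,4,5)] transfer[OF _ _ assms(2,1,3) simon_cong_sym[OF assms(5)]]
    by (blast intro: simon_congI)
qed

lemma simon_cong_cancel_arches:
  assumes "length as = p" "\<forall>a \<in> set as. is_arch S a" "concat as \<in> lists S"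
    and "length bs = p" "\<forall>b \<in> set bs. is_arch S b" "concat bs \<in> lists S"
    and "simon_cong (p + n) (concat as @ u) (concat bs @ v)"
  shows "simon_cong n u v"
  using assms
proof (induction p arbitrary: as bs)
  case 0
  then show ?case by simp
next
  case (Suc p)
  obtain a as' where as: "as = a # as'" using Suc.prems(1) by (cases as) auto
  obtain b bs' where bs: "bs = b # bs'" using Suc.prems(4) by (cases bs) auto
  have "simon_cong (p + n) (concat as' @ u) (concat bs' @ v)"
    by (rule simon_cong_cancel_arch[of S a b]) (use Suc.prems as bs in auto)
  with Suc.prems as bs show ?case by (intro Suc.IH[of as' bs']) simp_all
qed

lemma simon_cong_cancel_rev_arches:
  assumes "length as = p" "\<forall>a \<in> set as. is_arch S (rev a)" "concat as \<in> lists S"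
    and "length bs = p" "\<forall>b \<in> set bs. is_arch S (rev b)" "concat bs \<in> lists S"
    and "simon_cong (n + p) (u @ concat as) (v @ concat bs)"
  shows "simon_cong n u v"
proof -
  have "simon_cong (p + n) (concat (map rev (rev as)) @ rev u) (concat (map rev (rev bs)) @ rev v)"
    using assms(7) by (simp add: add.commute simon_cong_rev_iff flip: rev_concat rev_append)
  then have "simon_cong n (rev u) (rev v)"
    by (rule simon_cong_cancel_arches[where S = S, rotated -1])
      (use assms(1-6) in \<open>simp_all flip: rev_concat\<close>)
  then show ?thesis by (simp add: simon_cong_rev_iff)
qed

lemma univ_index_rev: "univ_index S (rev w) = univ_index S w"
proof -
  have "(\<forall>u \<in> lists S. length u = l \<longrightarrow> subseq u (rev w)) \<longleftrightarrow>
        (\<forall>u \<in> lists S. length u = l \<longrightarrow> subseq u w)" for l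
    by (metis length_rev rev_in_lists_iff rev_rev_ident subseq_rev_iff)
  then show ?thesis by (simp add: univ_index_def)
qed

lemma is_arch_ar:
  assumes "w \<in> lists S" "S \<noteq> {}" "1 \<le> i" "i \<le> univ_index S w"
  shows "is_arch S (ar S w i)"
proof -
  note fact = arch_factorization_is[OF assms(1,2)]
  have "i - 1 < length (fst (arch_factorization S w))"
    using univ_index_eq_length[OF assms(1) fact] assms(3,4) by simp
  then show ?thesis using fact by (auto simp: is_arch_factorization_def ar_def)
qed

lemma is_arch_rev_ra:
  assumes "w \<in> lists S" "S \<noteq> {}" "1 \<le> i" "i \<le> univ_index S w"
  shows "is_arch S (rev (ra S w i))"
  unfolding ra_def rev_rev_ident
  using assms by (intro is_arch_ar) (auto simp: univ_index_rev)

lemma alpha_beta_factorization_word: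
  assumes "is_alpha_beta_factorization S w \<alpha> \<beta>"
  shows "w = \<alpha> 0 @ concat (map (\<lambda>i. \<beta> (Suc i) @ \<alpha> (Suc i)) [0..<univ_index S w])"
proof -
  have "map (\<lambda>i. \<beta> i @ \<alpha> i) [1..<Suc (univ_index S w)] =
      map (\<lambda>i. \<beta> (Suc i) @ \<alpha> (Suc i)) [0..<univ_index S w]"
    by (simp flip: map_Suc_upt add: comp_def del: upt_Suc)
  then show ?thesis using assms unfolding is_alpha_beta_factorization_def by metis
qed

lemma alpha_beta_block_subset:
  assumes "is_alpha_beta_factorization S w \<alpha> \<beta>" "i < univ_index S w"
  shows "set (\<alpha> i @ \<beta> (Suc i) @ \<alpha> (Suc i)) \<subseteq> set w"
proof -
  have "set w = set (\<alpha> 0) \<union> (\<Union>j < univ_index S w. set (\<beta> (Suc j)) \<union> set (\<alpha> (Suc j)))"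
    using arg_cong[OF alpha_beta_factorization_word[OF assms(1)], of set] by auto
  with assms(2) show ?thesis by (cases i) (auto dest: Suc_lessD)
qed

text \<open>Blocks and arches are numbered from \<open>0\<close> here: \<open>block i\<close> is the paper's
  \<open>\<alpha>\<^sub>i \<beta>\<^sub>i\<^sub>+\<^sub>1 \<alpha>\<^sub>i\<^sub>+\<^sub>1\<close>, preceded in \<open>w\<close> by \<open>i\<close> arches.\<close>

locale alpha_beta_word =
  fixes S :: "'a set" and m :: nat and w :: "'a list" and \<alpha> \<beta> :: "nat \<Rightarrow> 'a list"
  assumes alphabet_nonempty: "S \<noteq> {}"
    and word_in_lists: "w \<in> lists S"
    and index: "m = univ_index S w"
    and factorization: "is_alpha_beta_factorization S w \<alpha> \<beta>"
begin

definition arches_before :: "nat \<Rightarrow> 'a list list" where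
  "arches_before i = map (\<lambda>j. \<alpha> j @ \<beta> (Suc j)) [0..<i]"

definition rev_arches_from :: "nat \<Rightarrow> 'a list list" where
  "rev_arches_from i = map (\<lambda>j. \<beta> (Suc j) @ \<alpha> (Suc j)) [i..<m]"

definition block :: "nat \<Rightarrow> 'a list" where
  "block i = \<alpha> i @ \<beta> (Suc i) @ \<alpha> (Suc i)"

lemma is_arch_alpha_beta:
  assumes "i < m"
  shows "is_arch S (\<alpha> i @ \<beta> (Suc i))"
proof -
  have "ar S w (Suc i) = \<alpha> i @ \<beta> (Suc i)"
    using factorization assms by (simp add: is_alpha_beta_factorization_def index)
  then show ?thesis
    using is_arch_ar[OF word_in_lists alphabet_nonempty, of "Suc i"] assms by (simp add: index)
qed

lemma is_arch_rev_beta_alpha: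
  assumes "i < m"
  shows "is_arch S (rev (\<beta> (Suc i) @ \<alpha> (Suc i)))"
proof -
  have "ra S w (Suc i) = \<beta> (Suc i) @ \<alpha> (Suc i)"
    using factorization assms by (simp add: is_alpha_beta_factorization_def index)
  then show ?thesis
    using is_arch_rev_ra[OF word_in_lists alphabet_nonempty, of "Suc i"] assms
    by (simp add: index del: rev_append)
qed

lemma universal_alpha_beta: "i < m \<Longrightarrow> universal S (Suc 0) (\<alpha> i @ \<beta> (Suc i))"
  using is_arch_subset[OF is_arch_alpha_beta] by (simp add: universal_Suc_0_iff)

lemma universal_beta_alpha: "i < m \<Longrightarrow> universal S (Suc 0) (\<beta> (Suc i) @ \<alpha> (Suc i))"
  using is_arch_subset[OF is_arch_rev_beta_alpha] by (auto simp: universal_Suc_0_iff)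

lemma length_arches_before [simp]: "length (arches_before i) = i"
  by (simp add: arches_before_def)

lemma length_rev_arches_from [simp]: "length (rev_arches_from i) = m - i"
  by (simp add: rev_arches_from_def)

lemma arches_before_0 [simp]: "arches_before 0 = []"
  by (simp add: arches_before_def)

lemma arches_before_Suc: "arches_before (Suc i) = arches_before i @ [\<alpha> i @ \<beta> (Suc i)]"
  by (simp add: arches_before_def)

lemma rev_arches_from_index [simp]: "rev_arches_from m = []"
  by (simp add: rev_arches_from_def)

lemma rev_arches_from_rec:
  "i < m \<Longrightarrow> rev_arches_from i = (\<beta> (Suc i) @ \<alpha> (Suc i)) # rev_arches_from (Suc i)"
  by (simp add: rev_arches_from_def upt_conv_Cons)

lemma is_arch_arches_before: "i \<le> m \<Longrightarrow> \<forall>a \<in> set (arches_before i). is_arch S a"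
  using is_arch_alpha_beta by (auto simp: arches_before_def)

lemma is_arch_rev_arches_from: "\<forall>a \<in> set (rev_arches_from i). is_arch S (rev a)"
  using is_arch_rev_beta_alpha by (auto simp: rev_arches_from_def simp del: rev_append)

lemma universal_arches_before: "i \<le> m \<Longrightarrow> universal S i (concat (arches_before i))"
  using universal_concat[of "arches_before i" S] is_arch_arches_before[of i]
  by (simp add: is_arch_subset)

lemma universal_rev_arches_from: "universal S (m - i) (concat (rev_arches_from i))"
  using universal_concat[of "rev_arches_from i" S] is_arch_rev_arches_from[of i]
    is_arch_subset[of S "rev _"]
  by simp

lemma word_eq_arches_alpha:
  "i \<le> m \<Longrightarrow> w = concat (arches_before i) @ \<alpha> i @ concat (rev_arches_from i)"
proof (induction i)
  case 0
  show ?case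
    using alpha_beta_factorization_word[OF factorization]
    by (simp add: rev_arches_from_def flip: index)
next
  case (Suc i)
  then show ?case by (simp add: arches_before_Suc rev_arches_from_rec)
qed

lemma word_eq_arches_block:
  "i < m \<Longrightarrow> w = concat (arches_before i) @ block i @ concat (rev_arches_from (Suc i))"
  using word_eq_arches_alpha[of i] by (simp add: rev_arches_from_rec block_def)

lemma factors_in_lists:
  assumes "i \<le> m"
  shows "concat (arches_before i) \<in> lists S" "\<alpha> i \<in> lists S" "concat (rev_arches_from i) \<in> lists S"
  using word_in_lists unfolding word_eq_arches_alpha[OF assms] append_in_lists_conv by blast+

lemma beta_in_lists: "i < m \<Longrightarrow> \<beta> (Suc i) \<in> lists S"
  using factors_in_lists(3)[of i] by (simp add: rev_arches_from_rec)

end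

locale alpha_beta_pair =
  A: alpha_beta_word S m w \<alpha> \<beta> + B: alpha_beta_word S m w' \<alpha>' \<beta>'
  for S :: "'a set" and m w \<alpha> \<beta> w' \<alpha>' \<beta>'
begin

lemmas in_lists = A.factors_in_lists B.factors_in_lists A.beta_in_lists B.beta_in_lists

lemma simon_cong_block:
  assumes "simon_cong (m + n) w w'" "i < m"
  shows "simon_cong (Suc n) (A.block i) (B.block i)"
proof -
  have "simon_cong (i + (Suc n + (m - Suc i)))
      (concat (A.arches_before i) @ A.block i @ concat (A.rev_arches_from (Suc i)))
      (concat (B.arches_before i) @ B.block i @ concat (B.rev_arches_from (Suc i)))"
    using assms A.word_eq_arches_block[of i] B.word_eq_arches_block[of i] by (simp add: ac_simps)
  then have "simon_cong (Suc n + (m - Suc i))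
      (A.block i @ concat (A.rev_arches_from (Suc i)))
      (B.block i @ concat (B.rev_arches_from (Suc i)))"
    by (rule simon_cong_cancel_arches[where S = S, rotated -1])
      (use assms(2) A.is_arch_arches_before[of i] B.is_arch_arches_before[of i] in
        \<open>simp_all add: in_lists\<close>)
  then show ?thesis
    by (rule simon_cong_cancel_rev_arches[where S = S, rotated -1])
      (use assms(2) A.is_arch_rev_arches_from B.is_arch_rev_arches_from in
        \<open>simp_all add: in_lists\<close>)
qed

lemma simon_cong_alpha_of_block:
  assumes "i < m" "simon_cong (Suc n) (A.block i) (B.block i)"
  shows "simon_cong n (\<alpha> i) (\<alpha>' i)" "simon_cong n (\<alpha> (Suc i)) (\<alpha>' (Suc i))"
proof -
  show "simon_cong n (\<alpha> i) (\<alpha>' i)"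
    by (rule simon_cong_cancel_rev_arches[of "[\<beta> (Suc i) @ \<alpha> (Suc i)]" "Suc 0" S
          "[\<beta>' (Suc i) @ \<alpha>' (Suc i)]"])
      (use assms A.is_arch_rev_beta_alpha[of i] B.is_arch_rev_beta_alpha[of i] in
        \<open>simp_all add: in_lists A.block_def B.block_def\<close>)
  show "simon_cong n (\<alpha> (Suc i)) (\<alpha>' (Suc i))"
    by (rule simon_cong_cancel_arch[of S "\<alpha> i @ \<beta> (Suc i)" "\<alpha>' i @ \<beta>' (Suc i)"])
      (use assms A.is_arch_alpha_beta[of i] B.is_arch_alpha_beta[of i] in
        \<open>simp_all add: in_lists A.block_def B.block_def\<close>)
qed

lemma simon_cong_exchange_beta:
  assumes "i < m" "simon_cong (Suc n) (A.block i) (B.block i)"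
  shows "simon_cong (Suc n) (\<alpha>' i @ \<beta> (Suc i) @ \<alpha> (Suc i)) (\<alpha>' i @ \<beta>' (Suc i) @ \<alpha> (Suc i))"
proof -
  note alphas = simon_cong_alpha_of_block[OF assms, THEN simon_cong_sym]
  have "simon_cong (Suc n) (\<alpha>' i @ \<beta> (Suc i) @ \<alpha> (Suc i)) (A.block i)"
    using simon_cong_append_right[OF A.universal_beta_alpha _ _ _ alphas(1)] assms(1)
    by (simp add: in_lists A.block_def)
  also note assms(2)
  also have "simon_cong (Suc n) (B.block i) (\<alpha>' i @ \<beta>' (Suc i) @ \<alpha> (Suc i))"
    using simon_cong_append_left[OF B.universal_alpha_beta _ _ _ alphas(2)] assms(1)
    by (simp add: in_lists B.block_def)
  finally show ?thesis .
qed

lemma simon_cong_replace_alpha: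
  assumes "i \<le> m" "simon_cong n (\<alpha> i) (\<alpha>' i)"
  shows "simon_cong (m + n)
    (concat (B.arches_before i) @ \<alpha> i @ concat (A.rev_arches_from i))
    (concat (B.arches_before i) @ \<alpha>' i @ concat (A.rev_arches_from i))"
proof -
  have levels: "m + n = i + n + (m - i)" using assms(1) by simp
  show ?thesis
    unfolding levels
    by (rule simon_cong_context[OF B.universal_arches_before A.universal_rev_arches_from
          _ _ _ _ assms(2)]) (use assms(1) in \<open>simp_all add: in_lists\<close>)
qed

lemma simon_cong_replace_beta:
  assumes "i < m" "simon_cong (Suc n) (A.block i) (B.block i)"
  shows "simon_cong (m + n)
    (concat (B.arches_before i) @ \<alpha>' i @ concat (A.rev_arches_from i))
    (concat (B.arches_before (Suc i)) @ \<alpha> (Suc i) @ concat (A.rev_arches_from (Suc i)))"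
proof -
  have levels: "m + n = i + Suc n + (m - Suc i)" using assms(1) by simp
  have "simon_cong (m + n)
      (concat (B.arches_before i) @ (\<alpha>' i @ \<beta> (Suc i) @ \<alpha> (Suc i)) @
        concat (A.rev_arches_from (Suc i)))
      (concat (B.arches_before i) @ (\<alpha>' i @ \<beta>' (Suc i) @ \<alpha> (Suc i)) @
        concat (A.rev_arches_from (Suc i)))"
    unfolding levels
    by (rule simon_cong_context[OF B.universal_arches_before A.universal_rev_arches_from
          _ _ _ _ simon_cong_exchange_beta[OF assms]])
      (use assms(1) in \<open>simp_all add: in_lists\<close>)
  then show ?thesis using assms(1) by (simp add: B.arches_before_Suc A.rev_arches_from_rec)
qed

lemma simon_cong_hybrid:
  assumes "\<And>i. i < m \<Longrightarrow> simon_cong (Suc n) (A.block i) (B.block i)" "0 < m" "i \<le> m"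
  shows "simon_cong (m + n) w (concat (B.arches_before i) @ \<alpha>' i @ concat (A.rev_arches_from i))"
  using assms(3)
proof (induction i)
  case 0
  have "simon_cong n (\<alpha> 0) (\<alpha>' 0)" using simon_cong_alpha_of_block(1) assms(1,2) by blast
  from simon_cong_replace_alpha[OF _ this] show ?case using A.word_eq_arches_alpha[of 0] by simp
next
  case (Suc i)
  then have "i < m" by simp
  note block = assms(1)[OF this]
  have "simon_cong (m + n) w
      (concat (B.arches_before i) @ \<alpha>' i @ concat (A.rev_arches_from i))"
    using Suc by simp
  also note simon_cong_replace_beta[OF \<open>i < m\<close> block]
  also note simon_cong_replace_alpha[OF Suc.prems simon_cong_alpha_of_block(2)[OF \<open>i < m\<close> block]]
  finally show ?case .
qed

lemma simon_cong_iff_blocks: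
  assumes "0 < m"
  shows "simon_cong (m + n) w w' \<longleftrightarrow> (\<forall>i < m. simon_cong (Suc n) (A.block i) (B.block i))"
proof
  assume "simon_cong (m + n) w w'"
  then show "\<forall>i < m. simon_cong (Suc n) (A.block i) (B.block i)" using simon_cong_block by blast
next
  assume "\<forall>i < m. simon_cong (Suc n) (A.block i) (B.block i)"
  then have "simon_cong (m + n) w
      (concat (B.arches_before m) @ \<alpha>' m @ concat (A.rev_arches_from m))"
    using simon_cong_hybrid[OF _ assms] by blast
  then show "simon_cong (m + n) w w'" using B.word_eq_arches_alpha[of m] by simp
qed

end

theorem theorem1:
  fixes S :: "'a set"
    and k m :: nat
    and w w' :: "'a list"
    and \<alpha> \<beta> \<alpha>' \<beta>' :: "nat \<Rightarrow> 'a list"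
  assumes "finite S"
    and "w \<in> lists S" and "w' \<in> lists S"
    and "m = univ_index S w" and "m = univ_index S w'"
    and "1 \<le> m" and "m < k"
    and "is_alpha_beta_factorization S w \<alpha> \<beta>"
    and "is_alpha_beta_factorization S w' \<alpha>' \<beta>'"
  shows "simon_cong k w w' \<longleftrightarrow>
    (\<forall>i \<in> {1..m}. simon_cong (k - m + 1)
        (\<alpha> (i - 1) @ \<beta> i @ \<alpha> i) (\<alpha>' (i - 1) @ \<beta>' i @ \<alpha>' i))"
proof -
  have "simon_cong k w w' \<longleftrightarrow> (\<forall>i < m. simon_cong (k - m + 1)
      (\<alpha> i @ \<beta> (Suc i) @ \<alpha> (Suc i)) (\<alpha>' i @ \<beta>' (Suc i) @ \<alpha>' (Suc i)))"
  proof (cases "S = {}")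
    case True
    \<comment> \<open>Here \<open>univ_index\<close> is a junk value, but both words and all their blocks are empty.\<close>
    then have "w = []" "w' = []" using assms(2,3) by auto
    then show ?thesis
      using alpha_beta_block_subset[OF assms(8)] alpha_beta_block_subset[OF assms(9)] assms(4,5)
      by (simp add: simon_cong_refl)
  next
    case False
    then interpret alpha_beta_pair S m w \<alpha> \<beta> w' \<alpha>' \<beta>'
      using assms by unfold_locales
    show ?thesis
      using simon_cong_iff_blocks[of "k - m"] assms(6,7) by (simp add: A.block_def B.block_def)
  qed
  then show ?thesis unfolding image_Suc_lessThan[symmetric] by auto
qed

end
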